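(* Let $h:\mathbb{R}^d\to\mathbb{R}$ be a differentiable function, and let $x_t:\mathbb{R}_{\ge0}\to\mathbb{R}^d$ be the state variable of a dynamical system, continuous with respect to time $t$ and such that the right-hand derivative $\dot x_t^+$ exists for all $t$. Let $\mathcal{C}=\{x:h(x)\ge0\}$, $\partial\mathcal{C}=\{x:h(x)=0\}$, $\mathrm{int}(\mathcal{C})=\mathcal{C}\setminus\partial\mathcal{C}$, and let $T>0$ be any finite time horizon. Suppose that: (S-1) $x_0\in\mathrm{int}(\mathcal{C})$; (S-2) $x_t\notin\mathrm{int}(\mathcal{C})\implies\dot h^+(x_t)>0$. Then $x_t\in\mathcal{C}$ for all $t\in[0,T]$.
   Context: $\dot x_t^+=\lim_{s\to0^+}\frac{x_{t+s}-x_t}{s}$ and $\dot h^+(x_t)=\lim_{s\to0^+}\frac{h(x_{t+s})-h(x_t)}{s}$ denote right-hand time derivatives along the trajectory. The sets $\partial\mathcal{C}$ and $\mathrm{int}(\mathcal{C})$ are as defined in the claim (so $\mathrm{int}(\mathcal{C})=\{x:h(x)>0\}$), not necessarily the topological boundary and interior. *)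

theory Defs
  imports "HOL-Analysis.Analysis"
begin

definition has_right_deriv :: "(real \<Rightarrow> 'a::real_normed_vector) \<Rightarrow> real \<Rightarrow> 'a \<Rightarrow> bool" where
  "has_right_deriv f t v \<longleftrightarrow> ((\<lambda>s. (f (t + s) - f t) /\<^sub>R s) \<longlongrightarrow> v) (at_right 0)"

text \<open>The value below is meaningful only where the right-hand limit exists; elsewhere it is an
  unspecified element.\<close>

definition right_deriv :: "(real \<Rightarrow> 'a::real_normed_vector) \<Rightarrow> real \<Rightarrow> 'a" where
  "right_deriv f t = Lim (at_right 0) (\<lambda>s. (f (t + s) - f t) /\<^sub>R s)"

definition safe_set :: "('a \<Rightarrow> real) \<Rightarrow> 'a set" where
  "safe_set h = {y. h y \<ge> 0}"

text \<open>The next two sets are determined by the sign of \<open>h\<close>; they need not coincide with the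
  topological \<open>frontier\<close> and \<open>interior\<close> of the safe set.\<close>

definition safe_boundary :: "('a \<Rightarrow> real) \<Rightarrow> 'a set" where
  "safe_boundary h = {y. h y = 0}"

definition safe_interior :: "('a \<Rightarrow> real) \<Rightarrow> 'a set" where
  "safe_interior h = safe_set h - safe_boundary h"

end

theory Submission
  imports Defs
begin

text \<open>Put \<open>g = h \<circ> x\<close>, which is continuous and, by the chain rule, right differentiable. If
  \<open>g t < 0\<close>, let \<open>s\<close> be the last time before \<open>t\<close> at which \<open>g s \<ge> 0\<close>. By continuity \<open>g s = 0\<close>, so
  the right derivative of \<open>g\<close> at \<open>s\<close> is positive and \<open>g\<close> is positive just after \<open>s\<close>, contradicting
  the choice of \<open>s\<close>.\<close>

text \<open>Gives access to the chain rule for \<open>has_vector_derivative\<close>; the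
  substitution \<open>y = t + s\<close> moves the limit to 0.\<close>

lemma has_right_deriv_iff_has_vector_derivative:
  "has_right_deriv f t v \<longleftrightarrow> (f has_vector_derivative v) (at_right t)"
proof -
  have "(f has_vector_derivative v) (at_right t) \<longleftrightarrow>
      ((\<lambda>y. (1 / norm (y - t)) *\<^sub>R (f y - (f t + (y - t) *\<^sub>R v))) \<longlongrightarrow> 0) (at_right t)"
    unfolding has_vector_derivative_def has_derivative_within
    by (simp add: bounded_linear_scaleR_left)
  also have "\<dots> \<longleftrightarrow>
      ((\<lambda>s. (1 / norm s) *\<^sub>R (f (t + s) - (f t + s *\<^sub>R v))) \<longlongrightarrow> 0) (at_right 0)"
    by (subst at_right_to_0) (simp add: filterlim_filtermap add.commute)
  \<comment> \<open>For \<open>s > 0\<close> one has \<open>norm s = s\<close>, so the two functions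
    agree on \<open>{0<..<1}\<close>; the bound 1 is arbitrary.\<close>
  also have "\<dots> \<longleftrightarrow> ((\<lambda>s. (f (t + s) - f t) /\<^sub>R s - v) \<longlongrightarrow> 0) (at_right 0)"
    by (intro filterlim_cong refl eventually_at_rightI[of 0 1])
      (simp_all add: algebra_simps divide_inverse)
  also have "\<dots> \<longleftrightarrow> has_right_deriv f t v"
    unfolding has_right_deriv_def by (rule LIM_zero_iff)
  finally show ?thesis by simp
qed

text \<open>The derivative of \<open>h\<close> at \<open>x t\<close> restricts to the image of
  \<open>{t<..}\<close> under \<open>x\<close>, as the chain rule within a set requires.\<close>

lemma has_right_deriv_compose:
  assumes "has_right_deriv x t v" and "(h has_derivative h') (at (x t))"
  shows "has_right_deriv (\<lambda>\<tau>. h (x \<tau>)) t (h' v)"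
  using vector_derivative_diff_chain_within[of x v t "{t<..}" h h'] assms
  by (simp add: has_right_deriv_iff_has_vector_derivative has_derivative_at_withinI o_def)

lemma right_deriv_eqI: "has_right_deriv f t v \<Longrightarrow> right_deriv f t = v"
  unfolding has_right_deriv_def right_deriv_def by (intro tendsto_Lim) auto

lemma has_right_deriv_pos_eventually_greater:
  fixes f :: "real \<Rightarrow> real"
  assumes "has_right_deriv f t v" and "v > 0"
  shows "\<forall>\<^sub>F s in at_right 0. f (t + s) > f t"
proof -
  have "\<forall>\<^sub>F s in at_right 0. (f (t + s) - f t) /\<^sub>R s > 0"
    using assms order_tendstoD(1) unfolding has_right_deriv_def by blast
  then show ?thesis
    using eventually_at_right_less[of 0]
    by eventually_elim (simp add: zero_less_mult_iff)
qed

lemma nonneg_if_right_deriv_pos: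
  fixes g :: "real \<Rightarrow> real"
  assumes cont: "continuous_on {a..} g" and "g a \<ge> 0"
    and deriv: "\<And>t. t \<ge> a \<Longrightarrow> g t \<le> 0 \<Longrightarrow> \<exists>v>0. has_right_deriv g t v"
    and "t \<ge> a"
  shows "g t \<ge> 0"
proof (rule ccontr)
  assume neg: "\<not> g t \<ge> 0"
  define S where "S = {u \<in> {a..t}. g u \<ge> 0}"
  \<comment> \<open>\<open>S\<close> is closed, bounded above and contains \<open>a\<close>, so the
    supremum is attained; it differs from \<open>t\<close> because \<open>g t < 0\<close>.\<close>
  define s where "s = Sup S"
  have "continuous_on {a..t} g"
    using cont by (rule continuous_on_subset) auto
  then have "closed S"
    unfolding S_def by (intro continuous_closed_preimage_constant
        continuous_on_closed_Collect_le continuous_on_const closed_atLeastAtMost)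
  moreover have "a \<in> S" and bdd: "bdd_above S"
    using assms by (auto simp: S_def)
  ultimately have "s \<in> S"
    unfolding s_def using closed_contains_Sup by blast
  then have s: "a \<le> s" "s < t" "g s \<ge> 0"
    using neg by (auto simp: S_def order_less_le)
  have after: "g u < 0" if "s < u" "u \<le> t" for u
    using that s cSup_upper[OF _ bdd, of u] unfolding s_def[symmetric]
    by (force simp: S_def)
  \<comment> \<open>As a limit from the right of negative values, \<open>g s\<close> is at most 0,
    so \<open>deriv\<close> applies at \<open>s\<close>.\<close>
  have "(g \<longlongrightarrow> g s) (at s within {a..})"
    using cont s(1) by (simp add: continuous_on_def)
  then have "(g \<longlongrightarrow> g s) (at_right s)"
    by (rule tendsto_within_subset) (use s in auto)
  moreover have "\<forall>\<^sub>F u in at_right s. g u \<le> 0"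
    using s(2) after by (intro eventually_at_rightI[of s t]) (auto intro: less_imp_le)
  ultimately have "g s \<le> 0"
    by (intro tendsto_upperbound) auto
  then obtain v where "v > 0" "has_right_deriv g s v"
    using deriv s(1) by blast
  then have "\<forall>\<^sub>F r in at_right 0. g (s + r) > g s"
    using has_right_deriv_pos_eventually_greater by blast
  moreover have "\<forall>\<^sub>F r in at_right 0. g (s + r) < 0"
    using s(2) after by (intro eventually_at_rightI[of 0 "t - s"]) auto
  \<comment> \<open>For small \<open>r > 0\<close>, both \<open>g (s + r) > g s \<ge> 0\<close> and
    \<open>g (s + r) < 0\<close>; this is absurd since \<open>at_right 0\<close> is a nontrivial
    filter.\<close>
  ultimately have "\<forall>\<^sub>F r::real in at_right 0. False"
    by eventually_elim (use s(3) in auto)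
  then show False by simp
qed

theorem mainTheorem4:
  fixes h :: "real ^ 'd \<Rightarrow> real"
    and x :: "real \<Rightarrow> real ^ 'd"
    and T :: real
  assumes h_diff: "\<And>y. h differentiable (at y)"
    and x_cont: "continuous_on {0..} x"
    and x_right_deriv: "\<And>t. t \<ge> 0 \<Longrightarrow> \<exists>v. has_right_deriv x t v"
    and T_pos: "T > 0"
    and S1: "x 0 \<in> safe_interior h"
    and S2: "\<And>t. t \<ge> 0 \<Longrightarrow> x t \<notin> safe_interior h \<Longrightarrow> right_deriv (\<lambda>\<tau>. h (x \<tau>)) t > 0"
  shows "\<forall>t\<in>{0..T}. x t \<in> safe_set h"
proof
  have interior: "y \<in> safe_interior h \<longleftrightarrow> h y > 0" for y
    by (auto simp: safe_interior_def safe_set_def safe_boundary_def)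
  have "continuous_on UNIV h"
    using h_diff by (simp add: differentiable_imp_continuous_on differentiable_on_def)
  then have cont: "continuous_on {0..} (\<lambda>\<tau>. h (x \<tau>))"
    using x_cont by (rule continuous_on_compose2) auto
  have deriv: "\<exists>v>0. has_right_deriv (\<lambda>\<tau>. h (x \<tau>)) t v" if t: "t \<ge> 0" "h (x t) \<le> 0" for t
  proof -
    obtain v h' where "has_right_deriv x t v" "(h has_derivative h') (at (x t))"
      using x_right_deriv[OF t(1)] h_diff[of "x t"] by (auto simp: differentiable_def)
    then have "has_right_deriv (\<lambda>\<tau>. h (x \<tau>)) t (h' v)"
      by (rule has_right_deriv_compose)
    \<comment> \<open>\<open>S2\<close> concerns the value \<open>right_deriv\<close>, unspecified
      where no limit exists. The chain rule has supplied the limit \<open>h' v\<close>, so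
      uniqueness of limits turns \<open>S2\<close> into \<open>h' v > 0\<close>.\<close>
    with S2[OF t(1)] t(2) show ?thesis
      by (auto simp: interior right_deriv_eqI)
  qed
  fix t assume "t \<in> {0..T}"
  then show "x t \<in> safe_set h"
    using nonneg_if_right_deriv_pos[OF cont _ deriv] S1 by (simp add: interior safe_set_def)
qed

end
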